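(* Let $T=T(r,s)$ be a tree with bipartition classes $R$ and $S$, where $|R|=r\le s=|S|$ and $r=\min(|R|,|S|)\ge 2$. For $m\ge r$ and $n$ sufficiently large compared to $m$, $r$, $s$, $$(r-1)\,n\;\le\;\mathrm{ex}(m,n;T(r,s))\;\le\;(r-1)\,n+O(m).$$
   Context: All graphs are finite, simple and undirected. For a graph $H$ and integers $m\le n$, $\mathrm{ex}(m,n;H)$ is the maximum number of edges in an $H$-free bipartite graph $G=(A,B;E)$ with parts $A,B$ of sizes $|A|=m$ and $|B|=n$. A graph $G$ contains $H$ if there is an injective map $\phi:V(H)\to V(G)$ such that $\phi(u)\phi(v)\in E(G)$ whenever $uv\in E(H)$; $G$ is $H$-free if it does not contain $H$. A tree $T$ is bipartite, and $T=T(r,s)$ indicates that its two bipartition classes $R$ and $S$ have sizes $|R|=r$ and $|S|=s$ with $r\le s$. *)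

theory Defs
  imports Main
begin

definition simple_graph :: "'a set \<Rightarrow> 'a set set \<Rightarrow> bool" where
  "simple_graph V E \<longleftrightarrow> finite V \<and> (\<forall>e\<in>E. e \<subseteq> V \<and> card e = 2)"

definition graph_connected :: "'a set \<Rightarrow> 'a set set \<Rightarrow> bool" where
  "graph_connected V E \<longleftrightarrow> V \<noteq> {} \<and> (\<forall>u\<in>V. \<forall>v\<in>V. (u, v) \<in> {(x, y). {x, y} \<in> E}\<^sup>*)"

definition graph_cycle :: "'a set set \<Rightarrow> 'a list \<Rightarrow> bool" where
  "graph_cycle E xs \<longleftrightarrow> 3 \<le> length xs \<and> distinct xs \<and>
     successively (\<lambda>x y. {x, y} \<in> E) xs \<and> {last xs, hd xs} \<in> E"

definition tree_graph :: "'a set \<Rightarrow> 'a set set \<Rightarrow> bool" where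
  "tree_graph V E \<longleftrightarrow> simple_graph V E \<and> graph_connected V E \<and> (\<nexists>xs. graph_cycle E xs)"

definition bipartition_classes :: "'a set \<Rightarrow> 'a set set \<Rightarrow> 'a set \<Rightarrow> 'a set \<Rightarrow> bool" where
  "bipartition_classes V E A B \<longleftrightarrow>
     A \<union> B = V \<and> A \<inter> B = {} \<and> (\<forall>e\<in>E. \<exists>a\<in>A. \<exists>b\<in>B. e = {a, b})"

definition contains_graph :: "'b set \<Rightarrow> 'b set set \<Rightarrow> 'a set \<Rightarrow> 'a set set \<Rightarrow> bool" where
  "contains_graph V E W F \<longleftrightarrow>
     (\<exists>\<phi>. inj_on \<phi> W \<and> \<phi> ` W \<subseteq> V \<and>
          (\<forall>u\<in>W. \<forall>v\<in>W. {u, v} \<in> F \<longrightarrow> {\<phi> u, \<phi> v} \<in> E))"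

text \<open>The host graphs have natural numbers as vertices, which covers all finite graphs up to
  isomorphism. A copy of the forbidden graph \<open>(W, F)\<close> may be placed on the host parts \<open>A\<close>, \<open>B\<close>
  either way round.\<close>

definition bip_free_sizes :: "nat \<Rightarrow> nat \<Rightarrow> 'a set \<Rightarrow> 'a set set \<Rightarrow> nat set" where
  "bip_free_sizes m n W F =
     {card E | (A :: nat set) (B :: nat set) E.
        simple_graph (A \<union> B) E \<and> bipartition_classes (A \<union> B) E A B \<and>
        card A = m \<and> card B = n \<and> \<not> contains_graph (A \<union> B) E W F}"

definition bip_ex :: "nat \<Rightarrow> nat \<Rightarrow> 'a set \<Rightarrow> 'a set set \<Rightarrow> nat" where
  "bip_ex m n W F = Max (bip_free_sizes m n W F)"

text \<open>The maximum is over a finite set, which is nonempty as soon as the forbidden graph has an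
  edge.\<close>

lemma finite_bip_free_sizes: "finite (bip_free_sizes m n W F)"
proof (rule finite_subset)
  show "bip_free_sizes m n W F \<subseteq> {..2 ^ (m + n)}"
  proof
    fix k assume "k \<in> bip_free_sizes m n W F"
    then obtain A B :: "nat set" and E where k: "k = card E"
      and g: "simple_graph (A \<union> B) E" and "bipartition_classes (A \<union> B) E A B"
      and c: "card A = m" "card B = n"
      unfolding bip_free_sizes_def by blast
    have "E \<subseteq> Pow (A \<union> B)" "finite (A \<union> B)" using g by (auto simp: simple_graph_def)
    then have "card E \<le> 2 ^ card (A \<union> B)"
      by (metis card_Pow card_mono finite_Pow_iff)
    also have "\<dots> \<le> 2 ^ (m + n)"
      using card_Un_le[of A B] c by (intro power_increasing) auto
    finally show "k \<in> {..2 ^ (m + n)}" using k by simp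
  qed
qed simp

lemma bip_free_sizes_nonempty:
  assumes "simple_graph W F" "F \<noteq> {}"
  shows "bip_free_sizes m n W F \<noteq> {}"
proof -
  obtain u v where uv: "u \<in> W" "v \<in> W" "{u, v} \<in> F"
    using assms by (fastforce simp: simple_graph_def card_2_iff)
  then have "\<not> contains_graph ({..<m} \<union> {m..<m + n}) {} W F"
    by (auto simp: contains_graph_def)
  then have "card ({} :: nat set set) \<in> bip_free_sizes m n W F"
    unfolding bip_free_sizes_def
    by (intro CollectI exI[of _ "{..<m}"] exI[of _ "{m..<m + n}"] exI[of _ "{}"])
       (auto simp: simple_graph_def bipartition_classes_def)
  then show ?thesis by blast
qed

end

theory Submission
  imports Defs
begin

text \<open>Lower bound: join \<open>r - 1\<close> of the \<open>m\<close> vertices to all \<open>n\<close> others. As the bipartition of a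
  connected graph is unique, a copy of the tree would place one of its classes inside these
  \<open>r - 1\<close> vertices.

  Upper bound: repeatedly delete a vertex of \<open>A\<close> of degree less than \<open>s\<close> or a vertex of \<open>B\<close> of
  degree less than \<open>r\<close>. If there are more than \<open>(s - 1) m + (r - 1) n\<close> edges, the process stops at
  a nonempty graph, in which the tree embeds greedily with \<open>R\<close> in \<open>A\<close> and \<open>S\<close> in \<open>B\<close>. Both bounds
  hold for all \<open>n\<close>.\<close>

section \<open>Growing a tree one leaf at a time\<close>

text \<open>The path is extended at its front. If the new vertex already lies on it, the path is cut
  back to that occurrence, so it stays distinct as \<open>graph_cycle\<close> demands. Staying
  inside \<open>U\<close> lets a vertex outside \<open>U\<close> close it to a cycle.\<close>

lemma distinct_path_of_rtrancl:
  assumes "(x, y) \<in> r\<^sup>*" "r \<subseteq> U \<times> U" "y \<in> U"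
  shows "\<exists>xs. xs \<noteq> [] \<and> hd xs = x \<and> last xs = y \<and> distinct xs \<and> set xs \<subseteq> U \<and>
              successively (\<lambda>a b. (a, b) \<in> r) xs"
  using assms(1)
proof (induction rule: converse_rtrancl_induct)
  case base
  show ?case using assms(3) by (intro exI[of _ "[y]"]) auto
next
  case (step x z)
  then obtain xs where xs: "xs \<noteq> []" "hd xs = z" "last xs = y" "distinct xs" "set xs \<subseteq> U"
    "successively (\<lambda>a b. (a, b) \<in> r) xs" by blast
  show ?case
  proof (cases "x \<in> set xs")
    case True
    then obtain ys zs where "xs = ys @ x # zs" by (meson split_list)
    then show ?thesis using xs
      by (intro exI[of _ "x # zs"]) (auto simp: successively_append_iff)
  next
    case False
    then show ?thesis using xs step.hyps(1) assms(2)
      by (intro exI[of _ "x # xs"]) (auto simp: successively_Cons)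
  qed
qed

text \<open>A second neighbour \<open>w\<close> of \<open>v\<close> would be joined to
  \<open>u\<close> by a path inside \<open>U\<close>, and \<open>v\<close> would close this path to
  a cycle.\<close>

lemma unique_neighbour_of_connected:
  assumes acyclic: "\<nexists>xs. graph_cycle E xs"
    and conn: "graph_connected U {e \<in> E. e \<subseteq> U}"
    and v: "v \<notin> U" and u: "u \<in> U" "{v, u} \<in> E"
  shows "{w \<in> U. {v, w} \<in> E} = {u}"
proof (rule ccontr)
  assume "{w \<in> U. {v, w} \<in> E} \<noteq> {u}"
  then obtain w where w: "w \<in> U" "{v, w} \<in> E" "w \<noteq> u" using u by blast
  let ?r = "{(x, y). {x, y} \<in> {e \<in> E. e \<subseteq> U}}"
  have "(u, w) \<in> ?r\<^sup>*" using conn u w unfolding graph_connected_def by blast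
  then obtain xs where xs: "xs \<noteq> []" "hd xs = u" "last xs = w" "distinct xs" "set xs \<subseteq> U"
    "successively (\<lambda>a b. (a, b) \<in> ?r) xs"
    using distinct_path_of_rtrancl[of u w ?r U] w by auto
  \<comment> \<open>The ends \<open>u\<close> and \<open>w\<close> differ; together with
    \<open>v\<close> this gives the three vertices a cycle needs.\<close>
  have "length xs \<ge> 2"
    using xs(1-3) w(3) by (cases xs rule: remdups_adj.cases) auto
  moreover have "successively (\<lambda>a b. {a, b} \<in> E) xs"
    by (rule successively_mono[OF xs(6)]) auto
  ultimately have "graph_cycle E (v # xs)"
    using xs u w v unfolding graph_cycle_def
    by (auto simp: successively_Cons insert_commute)
  with acyclic show False by blast
qed

lemma edge_leaving_set:
  assumes "graph_connected V E" "U \<subseteq> V" "U \<noteq> {}" "U \<noteq> V"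
  obtains u v where "u \<in> U" "v \<notin> U" "{v, u} \<in> E"
proof -
  obtain x y where xy: "x \<in> U" "y \<in> V" "y \<notin> U" using assms by blast
  then have "(x, y) \<in> {(x, y). {x, y} \<in> E}\<^sup>*"
    using assms unfolding graph_connected_def by blast
  \<comment> \<open>Invariant along the walk from \<open>x\<close>: it is still in \<open>U\<close>,
    or it has crossed an edge out of \<open>U\<close>.\<close>
  then have "y \<in> U \<or> (\<exists>u v. u \<in> U \<and> v \<notin> U \<and> {v, u} \<in> E)"
    by (induction rule: rtrancl_induct) (use xy in \<open>auto simp: insert_commute\<close>)
  then show ?thesis using xy that by blast
qed

lemma graph_connected_insert:
  assumes conn: "graph_connected U {e \<in> E. e \<subseteq> U}" and u: "u \<in> U" "{v, u} \<in> E"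
  shows "graph_connected (insert v U) {e \<in> E. e \<subseteq> insert v U}"
proof -
  let ?r = "\<lambda>U. {(x, y). {x, y} \<in> {e \<in> E. e \<subseteq> U}}"
  let ?q = "?r (insert v U)"
  have "(x, y) \<in> ?q\<^sup>*" if "x \<in> U" "y \<in> U" for x y
  proof -
    have "(x, y) \<in> (?r U)\<^sup>*" using conn that unfolding graph_connected_def by blast
    moreover have "?r U \<subseteq> ?q" by auto
    ultimately show ?thesis by (meson rtrancl_mono subsetD)
  qed
  moreover have "(v, u) \<in> ?q" "(u, v) \<in> ?q" using u by (auto simp: insert_commute)
  ultimately have "(x, u) \<in> ?q\<^sup>* \<and> (u, x) \<in> ?q\<^sup>*" if "x \<in> insert v U" for x
    using that u(1) by (auto intro: r_into_rtrancl)
  then show ?thesis unfolding graph_connected_def by (meson insert_not_empty rtrancl_trans)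
qed

text \<open>Any nonempty connected proper part of the tree has an edge leaving it, and acyclicity
  makes the outer end of that edge a leaf of the enlarged part. Hence the tree arises from a single
  vertex by attaching leaves.\<close>

lemma tree_graph_induct:
  assumes tree: "tree_graph V E"
    and single: "\<And>v. v \<in> V \<Longrightarrow> Q {v}"
    and grow: "\<And>U u v. U \<subseteq> V \<Longrightarrow> v \<in> V \<Longrightarrow> v \<notin> U \<Longrightarrow> u \<in> U \<Longrightarrow>
                 {w \<in> U. {v, w} \<in> E} = {u} \<Longrightarrow> Q U \<Longrightarrow> Q (insert v U)"
  shows "Q V"
proof -
  have fin: "finite V" and sub: "\<And>e. e \<in> E \<Longrightarrow> e \<subseteq> V"
    and conn: "graph_connected V E" and acyclic: "\<nexists>xs. graph_cycle E xs"
    using tree by (auto simp: tree_graph_def simple_graph_def)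
  obtain v0 where v0: "v0 \<in> V" using conn by (auto simp: graph_connected_def)
  have "1 \<le> card V" using v0 fin by (auto simp: Suc_le_eq card_gt_0_iff)
  \<comment> \<open>Connectedness is carried along because the uniqueness of the neighbour rests on
    it. At \<open>n = card V\<close> the set \<open>U\<close> is all of \<open>V\<close>.\<close>
  moreover have "\<exists>U\<subseteq>V. card U = n \<and> graph_connected U {e \<in> E. e \<subseteq> U} \<and> Q U"
    if "1 \<le> n" "n \<le> card V" for n
    using that
  proof (induction rule: dec_induct)
    case base
    show ?case using v0 single[OF v0]
      by (intro exI[of _ "{v0}"]) (auto simp: graph_connected_def)
  next
    case (step n)
    then obtain U where U: "U \<subseteq> V" "card U = n" "graph_connected U {e \<in> E. e \<subseteq> U}" "Q U"
      by auto
    then have "U \<noteq> {}" "U \<noteq> V" using step by auto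
    then obtain u v where uv: "u \<in> U" "v \<notin> U" "{v, u} \<in> E"
      using edge_leaving_set[OF conn U(1)] by blast
    have "v \<in> V" using sub uv(3) by blast
    then have "Q (insert v U)"
      using grow[OF U(1) _ uv(2,1) unique_neighbour_of_connected[OF acyclic U(3) uv(2,1,3)] U(4)]
      by blast
    moreover have "card (insert v U) = Suc n"
      using U uv fin by (simp add: finite_subset)
    ultimately show ?case
      using graph_connected_insert[OF U(3) uv(1,3)] U(1) \<open>v \<in> V\<close>
      by (intro exI[of _ "insert v U"] conjI) auto
  qed
  ultimately show ?thesis using card_subset_eq[OF fin] by (metis order_refl)
qed

section \<open>Greedy embedding under a minimum degree condition\<close>

text \<open>Supplies a free host vertex: \<open>X\<close> is a class of the tree, \<open>Z\<close>
  its part already placed, \<open>Y\<close> the candidates.\<close>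

lemma ex_not_in_image:
  assumes "finite X" "card X \<le> card Y" "Z \<subset> X"
  shows "\<exists>y\<in>Y. y \<notin> f ` Z"
proof (rule ccontr)
  assume "\<not> ?thesis"
  moreover have "finite Z" using assms finite_subset by blast
  ultimately have "card Y \<le> card Z"
    by (meson card_image_le card_mono finite_imageI order_trans subsetI)
  also have "card Z < card X" using assms by (intro psubset_card_mono) auto
  finally show False using assms(2) by simp
qed

text \<open>Each new leaf \<open>v\<close> has one placed neighbour \<open>u\<close>, so its image
  only has to be a free neighbour of the image of \<open>u\<close>. Candidates lie on the side of
  \<open>v\<close>, where only vertices of its own class compete; as \<open>v\<close> itself is
  unplaced, fewer than the whole class are there. \<open>P\<close> holds the host edges directed
  from \<open>A\<close> to \<open>B\<close>.\<close>

lemma tree_embeds_of_min_degree: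
  assumes tree: "tree_graph V F" and bip: "bipartition_classes V F R S"
    and AB: "A \<inter> B = {}" "A \<noteq> {}" "B \<noteq> {}"
    and degA: "\<And>a. a \<in> A \<Longrightarrow> card S \<le> card (P `` {a} \<inter> B)"
    and degB: "\<And>b. b \<in> B \<Longrightarrow> card R \<le> card (P\<inverse> `` {b} \<inter> A)"
  obtains \<phi> where "inj_on \<phi> V" "\<phi> ` R \<subseteq> A" "\<phi> ` S \<subseteq> B"
    "\<And>x y. x \<in> R \<Longrightarrow> y \<in> S \<Longrightarrow> {x, y} \<in> F \<Longrightarrow> (\<phi> x, \<phi> y) \<in> P"
proof -
  define Q where "Q U \<longleftrightarrow> (\<exists>\<phi>. inj_on \<phi> U \<and> \<phi> ` (U \<inter> R) \<subseteq> A \<and> \<phi> ` (U \<inter> S) \<subseteq> B \<and>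
    (\<forall>x\<in>U \<inter> R. \<forall>y\<in>U \<inter> S. {x, y} \<in> F \<longrightarrow> (\<phi> x, \<phi> y) \<in> P))" for U
  have RS: "R \<union> S = V" "R \<inter> S = {}" and edge: "\<And>e. e \<in> F \<Longrightarrow> \<exists>x\<in>R. \<exists>y\<in>S. e = {x, y}"
    using bip by (auto simp: bipartition_classes_def)
  have fin: "finite R" "finite S"
    using tree RS by (auto simp: tree_graph_def simple_graph_def)
  have "Q V"
  proof (rule tree_graph_induct[OF tree])
    fix v assume "v \<in> V"
    obtain a b where "a \<in> A" "b \<in> B" using AB by blast
    then show "Q {v}" unfolding Q_def using RS(2)
      by (intro exI[of _ "\<lambda>x. if x \<in> R then a else b"]) auto
  next
    fix U u v
    assume U: "U \<subseteq> V" and v: "v \<in> V" "v \<notin> U" and u: "u \<in> U"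
      and nb: "{w \<in> U. {v, w} \<in> F} = {u}" and "Q U"
    from \<open>Q U\<close> obtain \<phi> where \<phi>: "inj_on \<phi> U" "\<phi> ` (U \<inter> R) \<subseteq> A" "\<phi> ` (U \<inter> S) \<subseteq> B"
      and \<phi>P: "\<forall>x\<in>U \<inter> R. \<forall>y\<in>U \<inter> S. {x, y} \<in> F \<longrightarrow> (\<phi> x, \<phi> y) \<in> P"
      unfolding Q_def by (elim exE conjE)
    have vu: "{v, u} \<in> F" and only: "\<And>w. w \<in> U \<Longrightarrow> {v, w} \<in> F \<Longrightarrow> w = u" using nb by blast+
    obtain x y where xy: "x \<in> R" "y \<in> S" "{v, u} = {x, y}" using edge[OF vu] by blast
    then have "v \<in> R \<and> u \<in> S \<or> v \<in> S \<and> u \<in> R" by (auto simp: doubleton_eq_iff)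
    then show "Q (insert v U)"
    proof (elim disjE conjE)
      assume sides: "v \<in> R" "u \<in> S"
      have bu: "\<phi> u \<in> B" using \<phi>(3) u sides by blast
      have "\<exists>a\<in>P\<inverse> `` {\<phi> u} \<inter> A. a \<notin> \<phi> ` (U \<inter> R)"
        using ex_not_in_image[OF fin(1) degB[OF bu], of "U \<inter> R"] v(2) sides(1) by blast
      then obtain a where a: "(a, \<phi> u) \<in> P" "a \<in> A" "a \<notin> \<phi> ` (U \<inter> R)" by blast
      \<comment> \<open>Placed vertices of \<open>S\<close> sit in \<open>B\<close> and cannot
        occupy \<open>a\<close>.\<close>
      have "a \<notin> \<phi> ` (U \<inter> S)" using \<phi>(3) a(2) AB(1) by blast
      then have new: "a \<notin> \<phi> ` U" using a(3) U RS(1) by blast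
      have "v \<notin> S" using sides RS(2) by blast
      let ?\<psi> = "\<phi>(v := a)"
      have "inj_on ?\<psi> (insert v U)" using \<phi>(1) v(2) new by (auto simp: inj_on_def)
      moreover have "?\<psi> ` (insert v U \<inter> R) \<subseteq> A" "?\<psi> ` (insert v U \<inter> S) \<subseteq> B"
        using \<phi>(2,3) a(2) \<open>v \<notin> S\<close> by auto
      \<comment> \<open>The only new tree edge is the one to \<open>u\<close>; all others are
        inherited from \<open>\<phi>\<close>.\<close>
      moreover have "(?\<psi> x, ?\<psi> y) \<in> P"
        if "x \<in> insert v U \<inter> R" "y \<in> insert v U \<inter> S" "{x, y} \<in> F" for x y
        using that \<phi>P only[of y] a(1) \<open>v \<notin> S\<close> by auto
      ultimately show ?thesis unfolding Q_def by blast
    next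
      assume sides: "v \<in> S" "u \<in> R"
      have au: "\<phi> u \<in> A" using \<phi>(2) u sides by blast
      have "\<exists>b\<in>P `` {\<phi> u} \<inter> B. b \<notin> \<phi> ` (U \<inter> S)"
        using ex_not_in_image[OF fin(2) degA[OF au], of "U \<inter> S"] v(2) sides(1) by blast
      then obtain b where b: "(\<phi> u, b) \<in> P" "b \<in> B" "b \<notin> \<phi> ` (U \<inter> S)" by blast
      have "b \<notin> \<phi> ` (U \<inter> R)" using \<phi>(2) b(2) AB(1) by blast
      then have new: "b \<notin> \<phi> ` U" using b(3) U RS(1) by blast
      have "v \<notin> R" using sides RS(2) by blast
      let ?\<psi> = "\<phi>(v := b)"
      have "inj_on ?\<psi> (insert v U)" using \<phi>(1) v(2) new by (auto simp: inj_on_def)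
      moreover have "?\<psi> ` (insert v U \<inter> R) \<subseteq> A" "?\<psi> ` (insert v U \<inter> S) \<subseteq> B"
        using \<phi>(2,3) b(2) \<open>v \<notin> R\<close> by auto
      moreover have "(?\<psi> x, ?\<psi> y) \<in> P"
        if "x \<in> insert v U \<inter> R" "y \<in> insert v U \<inter> S" "{x, y} \<in> F" for x y
        using that \<phi>P only[of x] b(1) \<open>v \<notin> R\<close> by (auto simp: insert_commute)
      ultimately show ?thesis unfolding Q_def by blast
    qed
  qed
  then obtain \<phi> where "inj_on \<phi> V" "\<phi> ` (V \<inter> R) \<subseteq> A" "\<phi> ` (V \<inter> S) \<subseteq> B"
    "\<forall>x\<in>V \<inter> R. \<forall>y\<in>V \<inter> S. {x, y} \<in> F \<longrightarrow> (\<phi> x, \<phi> y) \<in> P"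
    unfolding Q_def by (elim exE conjE)
  moreover have "V \<inter> R = R" "V \<inter> S = S" using RS(1) by auto
  ultimately show ?thesis using that by auto
qed

section \<open>Deleting vertices of small degree\<close>

text \<open>Deleting a vertex of \<open>A\<close> of degree at most \<open>k\<close> loses at most
  \<open>k\<close> edges and lowers the left side of the inequality by exactly \<open>k\<close>, so
  the strict inequality survives; likewise for \<open>B\<close> and \<open>l\<close>.\<close>

lemma large_min_degree_subgraph:
  assumes "finite A" "finite B" "k * card A + l * card B < card (P \<inter> A \<times> B)"
  shows "\<exists>A'\<subseteq>A. \<exists>B'\<subseteq>B. A' \<noteq> {} \<and> B' \<noteq> {} \<and> (\<forall>a\<in>A'. k < card (P `` {a} \<inter> B')) \<and>
           (\<forall>b\<in>B'. l < card (P\<inverse> `` {b} \<inter> A'))"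
  using assms
proof (induction "card A + card B" arbitrary: A B rule: less_induct)
  case less
  show ?case
  proof (cases "(\<forall>a\<in>A. k < card (P `` {a} \<inter> B)) \<and> (\<forall>b\<in>B. l < card (P\<inverse> `` {b} \<inter> A))")
    case True
    \<comment> \<open>With an empty side there would be no edges, against the strict
      inequality.\<close>
    moreover have "A \<noteq> {}" "B \<noteq> {}" using less.prems(3) by auto
    ultimately show ?thesis by blast
  next
    case False
    then consider a where "a \<in> A" "card (P `` {a} \<inter> B) \<le> k"
      | b where "b \<in> B" "card (P\<inverse> `` {b} \<inter> A) \<le> l" by (auto simp: not_less)
    then show ?thesis
    proof cases
      case 1
      \<comment> \<open>The edges avoiding \<open>a\<close>, and the star at
        \<open>a\<close>.\<close>
      have "P \<inter> A \<times> B = P \<inter> (A - {a}) \<times> B \<union> Pair a ` (P `` {a} \<inter> B)" using 1 by auto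
      then have "card (P \<inter> A \<times> B) \<le> card (P \<inter> (A - {a}) \<times> B) + card (P `` {a} \<inter> B)"
        using less.prems(2) by (metis (no_types, lifting) card_Un_le card_image_le finite_Int
            add_left_mono order_trans)
      moreover have A: "card A = Suc (card (A - {a}))"
        using 1 less.prems(1) by (metis card_Suc_Diff1)
      ultimately have "k * card (A - {a}) + l * card B < card (P \<inter> (A - {a}) \<times> B)"
        using less.prems(3) 1(2) unfolding A mult_Suc_right by linarith
      then have "\<exists>A'\<subseteq>A - {a}. \<exists>B'\<subseteq>B. A' \<noteq> {} \<and> B' \<noteq> {} \<and>
          (\<forall>a\<in>A'. k < card (P `` {a} \<inter> B')) \<and> (\<forall>b\<in>B'. l < card (P\<inverse> `` {b} \<inter> A'))"
        using A less.prems(1,2) by (intro less.hyps) auto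
      then show ?thesis by (meson Diff_subset order_trans)
    next
      case 2
      have "P \<inter> A \<times> B = P \<inter> A \<times> (B - {b}) \<union> (\<lambda>a. (a, b)) ` (P\<inverse> `` {b} \<inter> A)" using 2 by auto
      then have "card (P \<inter> A \<times> B) \<le> card (P \<inter> A \<times> (B - {b})) + card (P\<inverse> `` {b} \<inter> A)"
        using less.prems(1) by (metis (no_types, lifting) card_Un_le card_image_le finite_Int
            add_left_mono order_trans)
      moreover have B: "card B = Suc (card (B - {b}))"
        using 2 less.prems(2) by (metis card_Suc_Diff1)
      ultimately have "k * card A + l * card (B - {b}) < card (P \<inter> A \<times> (B - {b}))"
        using less.prems(3) 2(2) unfolding B mult_Suc_right by linarith
      then have "\<exists>A'\<subseteq>A. \<exists>B'\<subseteq>B - {b}. A' \<noteq> {} \<and> B' \<noteq> {} \<and>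
          (\<forall>a\<in>A'. k < card (P `` {a} \<inter> B')) \<and> (\<forall>b\<in>B'. l < card (P\<inverse> `` {b} \<inter> A'))"
        using B less.prems(1,2) by (intro less.hyps) auto
      then show ?thesis by (meson Diff_subset order_trans)
    qed
  qed
qed

section \<open>The upper bound\<close>

text \<open>Since the parts are disjoint, each edge has just one orientation from \<open>A\<close>
  to \<open>B\<close>. This passes from edges to the relation used for degrees.\<close>

lemma card_edges_eq_card_pairs:
  assumes "bipartition_classes W E A B"
  shows "card E = card ({(a, b). {a, b} \<in> E} \<inter> A \<times> B)"
proof -
  have "bij_betw (\<lambda>(a, b). {a, b}) ({(a, b). {a, b} \<in> E} \<inter> A \<times> B) E"
    using assms unfolding bipartition_classes_def bij_betw_def inj_on_def
    by (fastforce simp: doubleton_eq_iff)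
  then show ?thesis by (simp add: bij_betw_same_card)
qed

text \<open>Embedding \<open>R\<close> into \<open>A\<close> requires degree \<open>card S\<close>
  in \<open>A\<close> and \<open>card R\<close> in \<open>B\<close>. The deletion thresholds are one
  less because surviving degrees exceed them strictly.\<close>

lemma card_edges_le_of_tree_free:
  assumes tree: "tree_graph V F" and bip: "bipartition_classes V F R S"
    and RS: "0 < card R" "0 < card S"
    and host: "simple_graph (A \<union> B) E" "bipartition_classes (A \<union> B) E A B"
    and free: "\<not> contains_graph (A \<union> B) E V F"
  shows "card E \<le> (card S - 1) * card A + (card R - 1) * card B"
proof (rule ccontr)
  assume "\<not> ?thesis"
  moreover define P where "P = {(a, b). {a, b} \<in> E}"
  ultimately have "(card S - 1) * card A + (card R - 1) * card B < card (P \<inter> A \<times> B)"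
    using card_edges_eq_card_pairs[OF host(2)] by simp
  moreover have "finite A" "finite B" using host(1) by (auto simp: simple_graph_def)
  ultimately obtain A' B' where sub: "A' \<subseteq> A" "B' \<subseteq> B" and ne: "A' \<noteq> {}" "B' \<noteq> {}"
    and degA: "\<And>a. a \<in> A' \<Longrightarrow> card S - 1 < card (P `` {a} \<inter> B')"
    and degB: "\<And>b. b \<in> B' \<Longrightarrow> card R - 1 < card (P\<inverse> `` {b} \<inter> A')"
    using large_min_degree_subgraph[of A B "card S - 1" "card R - 1" P] by blast
  have "A' \<inter> B' = {}" using sub host(2) by (auto simp: bipartition_classes_def)
  moreover have "card S \<le> card (P `` {a} \<inter> B')" if "a \<in> A'" for a
    using degA[OF that] RS by simp
  moreover have "card R \<le> card (P\<inverse> `` {b} \<inter> A')" if "b \<in> B'" for b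
    using degB[OF that] RS by simp
  ultimately obtain \<phi> where \<phi>: "inj_on \<phi> V" "\<phi> ` R \<subseteq> A'" "\<phi> ` S \<subseteq> B'"
    and \<phi>P: "\<And>x y. x \<in> R \<Longrightarrow> y \<in> S \<Longrightarrow> {x, y} \<in> F \<Longrightarrow> (\<phi> x, \<phi> y) \<in> P"
    using tree_embeds_of_min_degree[OF tree bip _ ne] by metis
  have V: "R \<union> S = V" using bip by (simp add: bipartition_classes_def)
  have "\<phi> ` V \<subseteq> A \<union> B" using \<phi>(2,3) sub unfolding V[symmetric] by blast
  moreover have "{\<phi> u, \<phi> v} \<in> E" if uv: "{u, v} \<in> F" for u v
  proof -
    obtain x y where "x \<in> R" "y \<in> S" "{u, v} = {x, y}"
      using bip uv unfolding bipartition_classes_def by blast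
    then show ?thesis using \<phi>P[of x y] uv
      by (auto simp: P_def doubleton_eq_iff insert_commute)
  qed
  ultimately have "contains_graph (A \<union> B) E V F"
    using \<phi>(1) unfolding contains_graph_def by blast
  with free show False by blast
qed

section \<open>The lower bound\<close>

text \<open>Edges of \<open>E\<close> switch membership in \<open>X\<close> and edges of
  \<open>F\<close> switch membership in \<open>R\<close>. So whether the two memberships agree is
  constant on the connected \<open>V\<close>: agreement puts \<open>R\<close> into \<open>X\<close>,
  disagreement puts \<open>S\<close> into \<open>X\<close>, and \<open>X\<close> is too small for
  either.\<close>

lemma connected_not_in_small_cover:
  assumes conn: "graph_connected V F" and bip: "bipartition_classes V F R S"
    and X: "finite X" "card X < card R" "card X < card S"
    and cover: "\<And>a b. {a, b} \<in> E \<Longrightarrow> (a \<in> X) \<noteq> (b \<in> X)"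
  shows "\<not> contains_graph W E V F"
proof
  assume "contains_graph W E V F"
  then obtain \<phi> where inj: "inj_on \<phi> V"
    and \<phi>: "\<forall>u\<in>V. \<forall>v\<in>V. {u, v} \<in> F \<longrightarrow> {\<phi> u, \<phi> v} \<in> E"
    unfolding contains_graph_def by (elim exE conjE)
  have RS: "R \<union> S = V" "R \<inter> S = {}" and edge: "\<And>e. e \<in> F \<Longrightarrow> \<exists>x\<in>R. \<exists>y\<in>S. e = {x, y}"
    using bip by (auto simp: bipartition_classes_def)
  have step: "(\<phi> u \<in> X \<longleftrightarrow> u \<in> R) \<longleftrightarrow> (\<phi> v \<in> X \<longleftrightarrow> v \<in> R)" if uv: "{u, v} \<in> F" for u v
  proof -
    obtain x y where "x \<in> R" "y \<in> S" "{u, v} = {x, y}" using edge[OF uv] by blast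
    moreover from this have "u \<in> V" "v \<in> V" using RS(1) by (auto simp: doubleton_eq_iff)
    then have "(\<phi> u \<in> X) \<noteq> (\<phi> v \<in> X)" using \<phi> uv by (intro cover) blast
    ultimately show ?thesis using RS(2) by (auto simp: doubleton_eq_iff)
  qed
  obtain v0 where v0: "v0 \<in> V" using conn by (auto simp: graph_connected_def)
  have same: "(\<phi> v0 \<in> X \<longleftrightarrow> v0 \<in> R) \<longleftrightarrow> (\<phi> v \<in> X \<longleftrightarrow> v \<in> R)" if "v \<in> V" for v
  proof -
    have "(v0, v) \<in> {(x, y). {x, y} \<in> F}\<^sup>*"
      using conn v0 that unfolding graph_connected_def by blast
    then show ?thesis by (induction rule: rtrancl_induct) (use step in auto)
  qed
  have "\<phi> ` R \<subseteq> X \<or> \<phi> ` S \<subseteq> X" using same RS by blast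
  moreover have "inj_on \<phi> R" "inj_on \<phi> S" using inj RS(1) by (auto intro: inj_on_subset)
  ultimately have "card R \<le> card X \<or> card S \<le> card X" using X(1) card_inj_on_le by metis
  then show False using X by linarith
qed

lemma tree_free_size:
  assumes conn: "graph_connected V F" and bip: "bipartition_classes V F R S"
    and k: "k < card R" "k < card S" "k \<le> m"
  shows "k * n \<in> bip_free_sizes m n V F"
proof -
  let ?B = "{m..<m + n}"
  define E where "E = (\<lambda>(a, b). {a, b}) ` ({..<k} \<times> ?B)"
  \<comment> \<open>As \<open>k \<le> m\<close>, the two factors are disjoint, so a pair can be
    recovered from its edge.\<close>
  have "inj_on (\<lambda>(a, b). {a, b}) ({..<k} \<times> ?B)"
    using k(3) by (auto simp: inj_on_def doubleton_eq_iff)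
  then have "card E = k * n" unfolding E_def by (simp add: card_image card_cartesian_product)
  moreover have "simple_graph ({..<m} \<union> ?B) E"
    using k(3) by (auto simp: simple_graph_def E_def card_insert_if)
  moreover have "bipartition_classes ({..<m} \<union> ?B) E {..<m} ?B"
    using k(3) by (fastforce simp: bipartition_classes_def E_def)
  moreover have "\<not> contains_graph ({..<m} \<union> ?B) E V F"
    by (rule connected_not_in_small_cover[OF conn bip, of "{..<k}"])
       (use k in \<open>auto simp: E_def doubleton_eq_iff\<close>)
  ultimately show ?thesis unfolding bip_free_sizes_def
    by (intro CollectI exI[of _ "{..<m}"] exI[of _ ?B] exI[of _ E]) auto
qed

theorem corollary1p3:
  fixes r s :: nat
  assumes "2 \<le> r" and "r \<le> s"
  shows "\<exists>C::nat. \<forall>m\<ge>r. \<exists>N. \<forall>n\<ge>N. \<forall>(V :: 'a set) E R S.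
           tree_graph V E \<and> bipartition_classes V E R S \<and> card R = r \<and> card S = s \<longrightarrow>
             (r - 1) * n \<le> bip_ex m n V E \<and>
             bip_ex m n V E \<le> (r - 1) * n + C * m"
proof (intro exI[of _ "s - 1"] exI[of _ 0] allI impI, elim conjE)
  fix m n and V :: "'a set" and F R S
  assume m: "r \<le> m" and tree: "tree_graph V F" and bip: "bipartition_classes V F R S"
    and card: "card R = r" "card S = s"
  let ?sizes = "bip_free_sizes m n V F"
  \<comment> \<open>Besides the lower bound, this shows that \<open>Max\<close> is taken over a
    nonempty set.\<close>
  have mem: "(r - 1) * n \<in> ?sizes"
    using tree assms m card by (intro tree_free_size[OF _ bip]) (auto simp: tree_graph_def)
  \<comment> \<open>The constant \<open>s - 1\<close> is the coefficient of \<open>card A\<close> in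
    the edge bound; it does not depend on \<open>m\<close>, \<open>n\<close> or the tree.\<close>
  moreover have "k \<le> (r - 1) * n + (s - 1) * m" if k: "k \<in> ?sizes" for k
  proof -
    obtain A B :: "nat set" and E where "k = card E" "card A = m" "card B = n"
      "simple_graph (A \<union> B) E" "bipartition_classes (A \<union> B) E A B"
      "\<not> contains_graph (A \<union> B) E V F"
      using k unfolding bip_free_sizes_def by blast
    then show ?thesis using card_edges_le_of_tree_free[OF tree bip] card assms by fastforce
  qed
  ultimately show "(r - 1) * n \<le> bip_ex m n V F \<and> bip_ex m n V F \<le> (r - 1) * n + (s - 1) * m"
    unfolding bip_ex_def using finite_bip_free_sizes[of m n V F]
    by (metis Max_ge Max_in empty_iff)
qed

end
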